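(* Let $U\subseteq\mathbb{C}^d$ be open, $T\subseteq\partial U$ and $W=U\cup T$. If there exists a $W$-completely universal function $f$, then $W\cap\partial W$ is both an $F_\sigma$ and a $G_\delta$ set.
   Context: Fix an enumeration $(N_j)_{j\ge0}$ of $\mathbb{N}^d$, $\mathbb{N}=\{0,1,2,\dots\}$. A differential operator of mixed partial derivatives is $D=\partial^{a_1+\dots+a_d}/\partial z_1^{a_1}\cdots\partial z_d^{a_d}$, $a\in\mathbb{N}^d$. For $f$ holomorphic on $U$ and $\zeta\in\overline U$ to which all $Df$ extend continuously, $S_N(f,\zeta)(z)=\sum_{j=0}^N a_{N_j}(f,\zeta)(z-\zeta)^{N_j}$, where $(z-\zeta)^a=\prod_i(z_i-\zeta_i)^{a_i}$ and, for $N_j=(a_1,\dots,a_d)$, $a_{N_j}(f,\zeta)=\frac{1}{a_1!\cdots a_d!}\frac{\partial^{a_1+\dots+a_d}f}{\partial z_1^{a_1}\cdots\partial z_d^{a_d}}(\zeta)$ (values of the continuous extensions at boundary points). For $K\subset\mathbb{C}^d$ compact, $A_D(K)$ is the set of continuous $h:K\to\mathbb{C}$ such that for every open disc $D\subset\mathbb{C}$ and every holomorphic mapping $\phi:D\to\mathbb{C}^d$ with $\phi(D)\subset K$, $h\circ\phi$ is holomorphic on $D$. $f$ is $W$-bipartite universal if (i) $f$ is holomorphic on $U$ and $Df$ is continuously extendable on $W$ for each differential operator of mixed partial derivatives $D$; (ii) for every compact $L\subseteq W$, every product $K$ of planar compact sets with connected complements with $K\subseteq\mathbb{C}^d\setminus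 W$, and every $h\in A_D(K)$, there exists a sequence $\lambda_n\in\mathbb{N}$ such that $\sup_{z\in K,\zeta\in L}|S_{\lambda_n}(f,\zeta)(z)-h(z)|\to0$ and $\sup_{z\in L,\zeta\in L}|DS_{\lambda_n}(f,\zeta)(z)-Df(z)|\to0$ for every differential operator of mixed partial derivatives $D$. $B(f)$ is the set of balanced points: those $z\in\partial U$ to which $Df$ can be continuously extended for all such $D$. $U(f,\zeta)$ is the set of $z\in\mathbb{C}^d$ such that the set of partial sums $\{S_n(f,\zeta)(z):n\ge 0\}$ is dense in $\mathbb{C}$. $f$ is $W$-completely universal if it is $W$-bipartite universal and $B(f)\cap U(f,\zeta)=\varnothing$ for every $\zeta\in W$; the set of such $f$ is denoted $C_u(W)$. *)

theory Defs
  imports "HOL-Analysis.Analysis"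
begin

text \<open>
  The space \<open>\<complex>\<^sup>d\<close> is \<^typ>\<open>complex ^ 'd\<close> with \<open>d = CARD('d)\<close>, and multi-indices are vectors of
  type \<^typ>\<open>nat ^ 'd\<close>.
\<close>

definition holomorphic_on_vec :: "(complex ^ 'd \<Rightarrow> complex) \<Rightarrow> (complex ^ 'd) set \<Rightarrow> bool" where
  "holomorphic_on_vec f U \<longleftrightarrow>
     (\<forall>z\<in>U. \<exists>f'. (f has_derivative f') (at z) \<and> Vector_Spaces.linear (*s) (*) f')"

definition partial_deriv :: "'d::finite \<Rightarrow> (complex ^ 'd \<Rightarrow> complex) \<Rightarrow> complex ^ 'd \<Rightarrow> complex" where
  "partial_deriv i f z = deriv (\<lambda>w. f (\<chi> k. if k = i then w else z $ k)) (z $ i)"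

text \<open>
  A finite type carries no canonical order, so an enumeration of the coordinates is fixed once
  and for all. The resulting order of differentiation is immaterial for holomorphic functions on
  an open set.
\<close>

definition coords :: "'d::finite list" where
  "coords = (SOME xs. distinct xs \<and> set xs = UNIV)"

definition mixed_deriv :: "nat ^ 'd \<Rightarrow> (complex ^ 'd \<Rightarrow> complex) \<Rightarrow> complex ^ 'd \<Rightarrow> complex" where
  "mixed_deriv a f = foldr (\<lambda>i. partial_deriv i ^^ (a $ i)) coords f"

definition cont_extendable ::
    "(complex ^ 'd) set \<Rightarrow> (complex ^ 'd) set \<Rightarrow> (complex ^ 'd \<Rightarrow> complex) \<Rightarrow> bool" where
  "cont_extendable U A g \<longleftrightarrow> (\<exists>G. continuous_on A G \<and> (\<forall>z\<in>U. G z = g z))"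

text \<open>
  The value at \<open>\<zeta>\<close> of the continuous extension of \<open>g\<close> from the open set \<open>U\<close>; meaningful for
  \<open>\<zeta>\<close> in the closure of \<open>U\<close> at which the extension exists. Functions are total in HOL, so the
  value \<open>g \<zeta>\<close> for \<open>\<zeta> \<notin> U\<close> carries no information and must not be used.
\<close>

definition ext_val ::
    "(complex ^ 'd) set \<Rightarrow> (complex ^ 'd \<Rightarrow> complex) \<Rightarrow> complex ^ 'd \<Rightarrow> complex" where
  "ext_val U g \<zeta> = (if \<zeta> \<in> U then g \<zeta> else Lim (at \<zeta> within U) g)"

definition taylor_coeff ::
    "(complex ^ 'd) set \<Rightarrow> (complex ^ 'd \<Rightarrow> complex) \<Rightarrow> complex ^ 'd \<Rightarrow> nat ^ 'd \<Rightarrow> complex" where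
  "taylor_coeff U f \<zeta> a = ext_val U (mixed_deriv a f) \<zeta> / (\<Prod>i\<in>UNIV. fact (a $ i))"

definition taylor_sum ::
    "(nat \<Rightarrow> nat ^ 'd) \<Rightarrow> (complex ^ 'd) set \<Rightarrow> (complex ^ 'd \<Rightarrow> complex) \<Rightarrow> nat \<Rightarrow>
      complex ^ 'd \<Rightarrow> complex ^ 'd \<Rightarrow> complex" where
  "taylor_sum N U f n \<zeta> z =
     (\<Sum>j\<le>n. taylor_coeff U f \<zeta> (N j) * (\<Prod>i\<in>UNIV. (z $ i - \<zeta> $ i) ^ (N j $ i)))"

definition A_D :: "(complex ^ 'd) set \<Rightarrow> (complex ^ 'd \<Rightarrow> complex) set" where
  "A_D K = {h. continuous_on K h \<and>
     (\<forall>c r (\<phi> :: complex \<Rightarrow> complex ^ 'd).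
        (\<forall>i. (\<lambda>w. \<phi> w $ i) holomorphic_on ball c r) \<and> \<phi> ` ball c r \<subseteq> K \<longrightarrow>
        (h \<circ> \<phi>) holomorphic_on ball c r)}"

text \<open>
  Convergence to \<open>0\<close> of the suprema of \<open>|S\<^bsub>m n\<^esub>(f,\<zeta>)(z) - h(z)|\<close> is expressed by
  \<^const>\<open>uniform_limit\<close> over the pairs \<open>(z,\<zeta>)\<close>. The second convergence involves the
  derivative of the partial sum with respect to \<open>z\<close>, for a fixed centre \<open>\<zeta>\<close>.
\<close>

definition bipartite_universal ::
    "(nat \<Rightarrow> nat ^ 'd) \<Rightarrow> (complex ^ 'd) set \<Rightarrow> (complex ^ 'd) set \<Rightarrow>
      (complex ^ 'd \<Rightarrow> complex) \<Rightarrow> bool" where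
  "bipartite_universal N U W f \<longleftrightarrow>
     holomorphic_on_vec f U \<and>
     (\<forall>a. cont_extendable U W (mixed_deriv a f)) \<and>
     (\<forall>L Ks K h.
        compact L \<and> L \<subseteq> W \<and>
        (\<forall>i. compact (Ks i) \<and> connected (- Ks i)) \<and>
        K = {z. \<forall>i. z $ i \<in> Ks i} \<and> K \<subseteq> - W \<and> h \<in> A_D K \<longrightarrow>
        (\<exists>m :: nat \<Rightarrow> nat.
           uniform_limit (K \<times> L) (\<lambda>n (z, \<zeta>). taylor_sum N U f (m n) \<zeta> z)
             (\<lambda>(z, \<zeta>). h z) sequentially \<and>
           (\<forall>a. uniform_limit (L \<times> L)
             (\<lambda>n (z, \<zeta>). mixed_deriv a (taylor_sum N U f (m n) \<zeta>) z)
             (\<lambda>(z, \<zeta>). ext_val U (mixed_deriv a f) z) sequentially)))"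

definition balanced_points ::
    "(complex ^ 'd) set \<Rightarrow> (complex ^ 'd \<Rightarrow> complex) \<Rightarrow> (complex ^ 'd) set" where
  "balanced_points U f =
     {z \<in> frontier U. \<forall>a. cont_extendable U (insert z U) (mixed_deriv a f)}"

definition univ_points ::
    "(nat \<Rightarrow> nat ^ 'd) \<Rightarrow> (complex ^ 'd) set \<Rightarrow> (complex ^ 'd \<Rightarrow> complex) \<Rightarrow>
      complex ^ 'd \<Rightarrow> (complex ^ 'd) set" where
  "univ_points N U f \<zeta> = {z. closure (range (\<lambda>n. taylor_sum N U f n \<zeta> z)) = UNIV}"

definition completely_universal ::
    "(nat \<Rightarrow> nat ^ 'd) \<Rightarrow> (complex ^ 'd) set \<Rightarrow> (complex ^ 'd) set \<Rightarrow>
      (complex ^ 'd \<Rightarrow> complex) set" where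
  "completely_universal N U W =
     {f. bipartite_universal N U W f \<and>
         (\<forall>\<zeta>\<in>W. balanced_points U f \<inter> univ_points N U f \<zeta> = {})}"

end

theory Submission
  imports Defs
begin

text \<open>
  Universality applied to the one-point set \<open>K = {z}\<close> and constant functions \<open>h\<close> shows that every
  \<open>z \<notin> W\<close> lies in \<open>U(f,\<zeta>)\<close>, for any \<open>\<zeta> \<in> W\<close>. As \<open>B(f)\<close> contains \<open>T\<close> and misses \<open>U(f,\<zeta>)\<close>, it follows
  that \<open>B(f) = T\<close>, and that \<open>W \<inter> \<partial>W\<close> equals both \<open>\<partial>W \<inter> B(f)\<close> and \<open>\<partial>W - U(f,\<zeta>)\<close>. Both \<open>B(f)\<close> and
  \<open>U(f,\<zeta>)\<close> are \<open>G\<^sub>\<delta>\<close> sets: the first is a set of points where countably many functions have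
  limits, the second is a set of points where a sequence of continuous functions has dense range.
\<close>

text \<open>Together with the next lemma this translates between the absolute notions of the theorem
  and the topology-relative ones used in the arguments below.\<close>

lemma fsigma_in_euclidean: "fsigma_in euclidean S \<longleftrightarrow> fsigma S"
  unfolding fsigma_in_def by (subst countable_union_of_explicit) (auto simp: fsigma.simps)

lemma gdelta_in_euclidean: "gdelta_in euclidean S \<longleftrightarrow> gdelta S"
  using fsigma_in_euclidean[of "- S"] gdelta_complement[of "- S"]
  by (simp add: gdelta_in_fsigma_in flip: Compl_eq_Diff_UNIV)

lemma atin_within_euclidean: "atin_within euclidean a S = at a within S"
  by (simp add: atin_within_def at_within_def nhdsin_def nhds_def)

text \<open>By completeness, a limit exists exactly when the oscillation of \<open>g\<close> along
  \<open>S\<close> over punctured balls around \<open>z\<close> tends to 0, and oscillation below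
  \<open>1/n\<close> is an open condition on \<open>z\<close>. Points with a trivial filter qualify
  vacuously.\<close>

lemma gdelta_in_points_of_limit:
  fixes g :: "'a::metric_space \<Rightarrow> 'b::complete_space"
  shows "gdelta_in euclidean {z. \<exists>l. (g \<longlongrightarrow> l) (at z within S)}"
  using gdelta_in_points_of_convergence_within[of euclidean euclidean S g]
  by (simp add: completely_metrizable_space_euclidean atin_within_euclidean
      metrizable_imp_t1_space metrizable_space_euclidean)

lemma gdelta_in_dense_range:
  fixes s :: "nat \<Rightarrow> 'a::topological_space \<Rightarrow> 'b::second_countable_topology"
  assumes "\<And>n. continuous_on UNIV (s n)"
  shows "gdelta_in euclidean {z. closure (range (\<lambda>n. s n z)) = UNIV}"
proof -
  obtain B :: "'b set set" where B: "countable B" "topological_basis B"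
    using ex_countable_basis by blast
  \<comment> \<open>No range meets the empty set, so it is removed; \<open>UNIV\<close> imposes no
    condition and keeps the family nonempty for \<open>gdelta_in_Inter\<close>.\<close>
  let ?B = "insert UNIV (B - {{}})"
  have "closure (range (\<lambda>n. s n z)) = UNIV \<longleftrightarrow> (\<forall>V\<in>?B. \<exists>n. s n z \<in> V)" for z
  proof
    assume dense: "closure (range (\<lambda>n. s n z)) = UNIV"
    show "\<forall>V\<in>?B. \<exists>n. s n z \<in> V"
    proof
      fix V assume "V \<in> ?B"
      then have "open V" "V \<noteq> {}"
        using B(2) by (auto simp: topological_basis_open)
      then have "V \<inter> range (\<lambda>n. s n z) \<noteq> {}"
        using dense open_Int_closure_eq_empty[of V "range (\<lambda>n. s n z)"] by auto
      then show "\<exists>n. s n z \<in> V" by auto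
    qed
  next
    assume meets: "\<forall>V\<in>?B. \<exists>n. s n z \<in> V"
    have "w \<in> closure (range (\<lambda>n. s n z))" for w
    proof (rule ccontr)
      assume "w \<notin> closure (range (\<lambda>n. s n z))"
      then obtain V where "V \<in> B" "w \<in> V" "V \<subseteq> - closure (range (\<lambda>n. s n z))"
        using topological_basisE[OF B(2), of "- closure (range (\<lambda>n. s n z))" w]
        by (metis Compl_iff closed_closure open_Compl)
      then have "V \<in> ?B" "V \<inter> range (\<lambda>n. s n z) = {}"
        using closure_subset[of "range (\<lambda>n. s n z)"] by blast+
      moreover obtain n where "s n z \<in> V"
        using bspec[OF meets \<open>V \<in> ?B\<close>] ..
      ultimately show False
        by blast
    qed
    then show "closure (range (\<lambda>n. s n z)) = UNIV" by auto
  qed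
  then have eq: "{z. closure (range (\<lambda>n. s n z)) = UNIV} = \<Inter> ((\<lambda>V. \<Union>n. s n -` V) ` ?B)"
    by (intro set_eqI) (simp only: mem_Collect_eq INT_iff UN_iff vimage_eq bex_UNIV)
  have "gdelta_in euclidean (\<Union>n. s n -` V)" if "V \<in> ?B" for V
  proof -
    have "open V"
      using that B(2) by (auto simp: topological_basis_open)
    then have "open (\<Union>n. s n -` V)"
      using assms by (intro open_UN ballI open_vimage)
    then show ?thesis
      by (simp add: open_imp_gdelta_in)
  qed
  moreover have "countable ((\<lambda>V. \<Union>n. s n -` V) ` ?B)"
    using B(1) by (intro countable_image countable_insert countable_Diff)
  ultimately show ?thesis
    unfolding eq by (intro gdelta_in_Inter) blast+
qed

lemma cont_extendable_insert_iff:
  assumes "open U" "z \<notin> U" "continuous_on U g"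
  shows "cont_extendable U (insert z U) g \<longleftrightarrow> (\<exists>l. (g \<longlongrightarrow> l) (at z within U))"
proof
  assume "cont_extendable U (insert z U) g"
  then obtain G where G: "continuous_on (insert z U) G" "\<And>x. x \<in> U \<Longrightarrow> G x = g x"
    unfolding cont_extendable_def by blast
  then have "(G \<longlongrightarrow> G z) (at z within insert z U)"
    by (simp add: continuous_on_def)
  then have "(G \<longlongrightarrow> G z) (at z within U)"
    by (rule tendsto_within_subset) auto
  then have "(g \<longlongrightarrow> G z) (at z within U)"
    by (rule Lim_transform_eventually) (simp add: G eventually_at_filter)
  then show "\<exists>l. (g \<longlongrightarrow> l) (at z within U)" ..
next
  assume "\<exists>l. (g \<longlongrightarrow> l) (at z within U)"
  then obtain l where l: "(g \<longlongrightarrow> l) (at z within U)" ..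
  define G where "G = g(z := l)"
  have G: "G x = g x" if "x \<in> U" for x
    using that assms(2) by (auto simp: G_def)
  have "(G \<longlongrightarrow> G x) (at x within insert z U)" if x: "x \<in> insert z U" for x
  proof (cases "x = z")
    case True
    have "(G \<longlongrightarrow> l) (at z within U)"
      using l by (rule Lim_transform_eventually) (simp add: G eventually_at_filter)
    then show ?thesis
      using True by (simp add: G_def at_within_def)
  next
    case False
    with x have "x \<in> U" by simp
    \<comment> \<open>As \<open>U\<close> is open, continuity at \<open>x\<close> is a matter of a
      neighbourhood inside \<open>U\<close>, so the new value at \<open>z\<close> has no
      influence.\<close>
    have "continuous_on U G"
      using assms(3) G by (simp cong: continuous_on_cong)
    then have "isCont G x"
      using \<open>x \<in> U\<close> assms(1) continuous_on_eq_continuous_at by blast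
    then show ?thesis
      unfolding isCont_def by (rule tendsto_within_subset) simp
  qed
  then have "continuous_on (insert z U) G"
    by (simp add: continuous_on_def)
  with G show "cont_extendable U (insert z U) g"
    unfolding cont_extendable_def by blast
qed

text \<open>There are only countably many multi-indices, so the intersection over all mixed
  derivatives stays \<open>G\<^sub>\<delta>\<close>; the frontier is closed in a metric
  space.\<close>

lemma gdelta_in_balanced_points:
  assumes "open U" "\<And>a. continuous_on U (mixed_deriv a f)"
  shows "gdelta_in euclidean (balanced_points U f)"
proof -
  have "z \<notin> U" if "z \<in> frontier U" for z
    using that assms(1) by (simp add: frontier_def interior_open)
  then have "balanced_points U f =
      frontier U \<inter> \<Inter> (range (\<lambda>a. {z. \<exists>l. (mixed_deriv a f \<longlongrightarrow> l) (at z within U)}))"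
    unfolding balanced_points_def using assms by (auto simp: cont_extendable_insert_iff)
  moreover have "gdelta_in euclidean (frontier U)"
    by (simp add: closed_imp_gdelta_in metrizable_space_euclidean)
  moreover have "gdelta_in euclidean
      (\<Inter> (range (\<lambda>a. {z. \<exists>l. (mixed_deriv a f \<longlongrightarrow> l) (at z within U)})))"
    using gdelta_in_points_of_limit by (intro gdelta_in_Inter) auto
  ultimately show ?thesis
    by (simp add: gdelta_in_Int)
qed

lemma bipartite_universal_univ_points:
  assumes "bipartite_universal N U W f" "\<zeta> \<in> W" "z \<notin> W"
  shows "z \<in> univ_points N U f \<zeta>"
proof -
  have "w \<in> closure (range (\<lambda>n. taylor_sum N U f n \<zeta> z))" for w
  proof -
    have "connected (- {z $ i})" for i
      by (simp add: connected_punctured_universe)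
    moreover have "{z} = {x. \<forall>i. x $ i \<in> {z $ i}}"
      by (auto simp: vec_eq_iff)
    moreover have "(\<lambda>_. w) \<in> A_D {z}"
      by (simp add: A_D_def o_def)
    ultimately have "\<exists>m. uniform_limit ({z} \<times> {\<zeta>}) (\<lambda>n (z, \<zeta>). taylor_sum N U f (m n) \<zeta> z)
        (\<lambda>(z, \<zeta>). w) sequentially"
      using assms(1)[unfolded bipartite_universal_def, THEN conjunct2, THEN conjunct2,
          THEN spec, of "{\<zeta>}", THEN spec, of "\<lambda>i. {z $ i}", THEN spec, of "{z}",
          THEN spec, of "\<lambda>_. w"] assms(2,3)
      by fastforce
    then obtain m where
      lim: "uniform_limit ({z} \<times> {\<zeta>}) (\<lambda>n (z, \<zeta>). taylor_sum N U f (m n) \<zeta> z)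
        (\<lambda>(z, \<zeta>). w) sequentially" ..
    \<comment> \<open>The indices \<open>m n\<close> need not increase: the values only have to be
      partial sums that approach \<open>w\<close>.\<close>
    from tendsto_uniform_limitI[OF lim, of "(z, \<zeta>)"]
    have "(\<lambda>n. taylor_sum N U f (m n) \<zeta> z) \<longlonglongrightarrow> w" by simp
    then show ?thesis
      unfolding closure_sequential
      by (intro exI[of _ "\<lambda>n. taylor_sum N U f (m n) \<zeta> z"]) auto
  qed
  then show ?thesis by (auto simp: univ_points_def)
qed

text \<open>For a fixed centre each partial sum is a polynomial in the other variable, hence
  continuous on the whole space.\<close>

lemma gdelta_in_univ_points: "gdelta_in euclidean (univ_points N U f \<zeta>)"
  unfolding univ_points_def taylor_sum_def
  by (intro gdelta_in_dense_range continuous_intros)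

theorem theorem4p9:
  fixes N :: "nat \<Rightarrow> nat ^ 'd" and U T W :: "(complex ^ 'd) set"
  assumes "bij N"
    and "open U" and "T \<subseteq> frontier U" and "W = U \<union> T"
    and "\<exists>f. f \<in> completely_universal N U W"
  shows "fsigma (W \<inter> frontier W) \<and> gdelta (W \<inter> frontier W)"
proof (cases "W = {}")
  case True
  then show ?thesis
    by (simp flip: fsigma_in_euclidean gdelta_in_euclidean)
next
  case False
  then obtain \<zeta> where \<zeta>: "\<zeta> \<in> W" by blast
  obtain f where f: "bipartite_universal N U W f"
    and disj: "balanced_points U f \<inter> univ_points N U f \<zeta> = {}"
    using assms(5) \<zeta> unfolding completely_universal_def by blast
  have ext: "cont_extendable U W (mixed_deriv a f)" for a
    using f unfolding bipartite_universal_def by blast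
  \<comment> \<open>Continuity is read off from the extension to \<open>W\<close>, which agrees with
    the derivative on \<open>U\<close>.\<close>
  have cont: "continuous_on U (mixed_deriv a f)" for a
  proof -
    obtain G where "continuous_on W G" "\<forall>z\<in>U. G z = mixed_deriv a f z"
      using ext[of a] unfolding cont_extendable_def by blast
    moreover have "U \<subseteq> W" using assms(4) by blast
    ultimately show ?thesis
      using continuous_on_subset continuous_on_cong by metis
  qed
  have T: "T \<subseteq> balanced_points U f"
  proof
    fix z assume "z \<in> T"
    then have "insert z U \<subseteq> W" using assms(4) by blast
    then have "cont_extendable U (insert z U) (mixed_deriv a f)" for a
      using ext[of a] unfolding cont_extendable_def by (meson continuous_on_subset)
    with \<open>z \<in> T\<close> assms(3) show "z \<in> balanced_points U f"
      by (auto simp: balanced_points_def)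
  qed
  have out: "- W \<subseteq> univ_points N U f \<zeta>"
    using bipartite_universal_univ_points[OF f \<zeta>] by blast
  have "U \<subseteq> interior W"
    using assms(2,4) by (simp add: interior_maximal)
  then have "U \<inter> frontier W = {}"
    by (auto simp: frontier_def)
  \<comment> \<open>A point of \<open>W\<close> on its frontier lies in \<open>T\<close>, so it is
    balanced and not in \<open>univ_points\<close>. A frontier point outside \<open>W\<close> lies
    in \<open>univ_points\<close> and so is not balanced.\<close>
  with T out disj assms(4) have
    F: "W \<inter> frontier W = frontier W - univ_points N U f \<zeta>" and
    G: "W \<inter> frontier W = frontier W \<inter> balanced_points U f"
    by blast+
  have "fsigma_in euclidean (W \<inter> frontier W)"
    unfolding F by (intro fsigma_in_diff gdelta_in_univ_points) (simp add: closed_imp_fsigma_in)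
  moreover have "gdelta_in euclidean (W \<inter> frontier W)"
    unfolding G by (intro gdelta_in_Int gdelta_in_balanced_points cont assms(2))
      (simp add: closed_imp_gdelta_in metrizable_space_euclidean)
  ultimately show ?thesis
    by (simp add: fsigma_in_euclidean gdelta_in_euclidean)
qed

end
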